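(* There is an absolute constant $C$ such that the following holds. Let $p\ge 2$ and $k\ge 3$ be integers, and let $\mathcal F$ be a family of compact convex sets in the plane satisfying the $(p,2)$-property. Assume that every $k$ members of $\mathcal F$ have union complexity less than $\binom k2$. Then $\mathcal F$ has a transversal of size at most $C k^4p^{16}$.
   Context: A family $\mathcal F$ of sets satisfies the $(p,q)$-property if $|\mathcal F|\ge p$, no member is empty, and among any $p$ members there are $q$ with a common point. A transversal of $\mathcal F$ is a set meeting every member of $\mathcal F$. The union complexity of a finite family $\mathcal G$ of planar regions is the number of vertices (points belonging to the boundaries of two distinct members of $\mathcal G$) that lie on the boundary of $\bigcup_{G\in\mathcal G}G$. *)

theory Defs
  imports "HOL-Analysis.Analysis"
begin

type_synonym point = "real ^ 2"

definition pq_property :: "nat \<Rightarrow> nat \<Rightarrow> point set set \<Rightarrow> bool" where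
  "pq_property p q F \<longleftrightarrow>
     (infinite F \<or> p \<le> card F) \<and>
     {} \<notin> F \<and>
     (\<forall>S \<subseteq> F. finite S \<and> card S = p \<longrightarrow>
        (\<exists>Q \<subseteq> S. card Q = q \<and> \<Inter>Q \<noteq> {}))"

definition transversal :: "point set \<Rightarrow> point set set \<Rightarrow> bool" where
  "transversal T F \<longleftrightarrow> (\<forall>A \<in> F. T \<inter> A \<noteq> {})"

definition union_vertices :: "point set set \<Rightarrow> point set" where
  "union_vertices G = {x. (\<exists>A\<in>G. \<exists>B\<in>G. A \<noteq> B \<and> x \<in> frontier A \<and> x \<in> frontier B)
                          \<and> x \<in> frontier (\<Union>G)}"

text \<open>Union complexity less than m (an infinite vertex set counts as infinite complexity).\<close>
definition union_complexity_less :: "point set set \<Rightarrow> nat \<Rightarrow> bool" where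
  "union_complexity_less G m \<longleftrightarrow> finite (union_vertices G) \<and> card (union_vertices G) < m"

end

theory Submission
  imports Defs
begin

text \<open>Pairwise meeting compact convex sets, no three with a common point, have a vertex of the union for each
  pair, because the frontier of the union of two of them is connected. The four orders of Larman, Matousek,
  Pach and Toeroecsik on disjoint convex sets therefore show that among any \<open>P = k p\<^sup>4\<close> members three have a
  common point. As in the Alon--Kleitman method, random sampling and fractional Helly give, for all weights
  on a finite subfamily, a point in a fraction \<open>1 / (16 P\<^sup>2)\<close> of the weight; multiplicative weights turn this
  into a list of points of which every member contains a fraction \<open>1 / (64 P\<^sup>2)\<close>; and a weak net of size
  quadratic in \<open>64 P\<^sup>2\<close> is the transversal. Compactness passes to infinite families.\<close>

section \<open>Vertices of the union of pairwise meeting sets\<close>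

text \<open>The (p,2)-property speaks of pairs, while fractional Helly in the plane needs triples.
  The complexity bound bridges this gap: in a family without triple points it rules out
  \<open>k\<close> pairwise meeting members. The triple count is needed for all weights because a
  single heavy point serves only the members through it, whereas the final list must give every
  member its share. The length of that list depends on the finite subfamily, but this is harmless,
  since the size of the net depends on the share alone. The constant is 147456 = 36 * 64^2: a net
  for share \<open>s\<close> has at most \<open>36 / s^2\<close> points, here
  \<open>s = 1 / (64 * P^2)\<close>, and \<open>P^4 = k^4 * p^16\<close>.\<close>

lemma subset_if_frontier_Un_subset:
  fixes A B :: "point set"
  assumes "compact A" "convex A" "compact B" "frontier (A \<union> B) \<subseteq> A"
  shows "B \<subseteq> A"
proof (rule ccontr)
  assume "\<not> B \<subseteq> A"
  then have 1: "(- A) \<inter> (A \<union> B) \<noteq> {}" by blast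
  have bd: "bounded (A \<union> B)" using assms by (simp add: compact_imp_bounded)
  have 2: "(- A) - (A \<union> B) \<noteq> {}"
    using bd not_bounded_UNIV[where 'a=point] bounded_subset[of "A \<union> B" UNIV] by blast
  \<comment> \<open>A point of \<open>B - A\<close> and a point outside the bounded union both lie
    in this connected set, which therefore meets the frontier of
    \<open>A \<union> B\<close>.\<close>
  have "connected (- A)"
    using assms by (intro connected_complement_bounded_convex) (auto simp: compact_imp_bounded)
  from connected_Int_frontier[OF this 1 2] assms(4) show False by blast
qed

text \<open>The union is starlike about a common point, so it and its complement are connected, and
  hence so is its frontier. Covered by the closed sets \<open>A\<close> and \<open>B\<close>, a
  connected frontier either meets \<open>A \<inter> B\<close> or lies in one of them, which then
  swallows the other.\<close>

lemma convex_pair_meets_frontier_Un: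
  fixes A B :: "point set"
  assumes A: "compact A" "convex A" and B: "compact B" "convex B"
    and AB: "A \<inter> B \<noteq> {}" "\<not> A \<subseteq> B" "\<not> B \<subseteq> A"
  shows "A \<inter> B \<inter> frontier (A \<union> B) \<noteq> {}"
proof
  assume empty: "A \<inter> B \<inter> frontier (A \<union> B) = {}"
  have cl: "closed (A \<union> B)" and bd: "bounded (A \<union> B)"
    using A B by (auto simp: compact_imp_bounded compact_imp_closed)
  obtain z where z: "z \<in> A" "z \<in> B" using AB by blast
  have st: "starlike (A \<union> B)"
    unfolding starlike_def
  proof (intro bexI ballI)
    fix x assume "x \<in> A \<union> B"
    then show "closed_segment z x \<subseteq> A \<union> B"
      using z A(2) B(2) by (auto simp: convex_contains_segment)
  qed (use z in auto)
  have "compact (A \<union> B)" using A B by blast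
  \<comment> \<open>Borsuk's criterion: the complement is connected iff all maps to the circle are
    null-homotopic, as they are on a contractible set.\<close>
  then have "connected (- (A \<union> B)) \<longleftrightarrow>
      (\<forall>f. continuous_on (A \<union> B) f \<and> f \<in> A \<union> B \<rightarrow> sphere (0::point) 1 \<longrightarrow>
        (\<exists>c. homotopic_with_canon (\<lambda>x. True) (A \<union> B) (sphere 0 1) f (\<lambda>x. c)))"
    by (rule Borsuk_separation_theorem) simp
  moreover have "\<exists>c. homotopic_with_canon (\<lambda>x. True) (A \<union> B) (sphere 0 1) f (\<lambda>x. c)"
    if "continuous_on (A \<union> B) f \<and> f \<in> A \<union> B \<rightarrow> sphere (0::point) 1" for f
    using nullhomotopic_from_contractible[OF _ _ starlike_imp_contractible[OF st]] that by metis
  ultimately have "connected (- (A \<union> B))" by blast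
  then have "connected (frontier (A \<union> B))"
    by (rule connected_frontier_simple[OF starlike_imp_connected[OF st]])
  moreover have "frontier (A \<union> B) \<subseteq> A \<union> B"
    using cl by (simp add: frontier_subset_closed)
  ultimately have "A \<inter> frontier (A \<union> B) = {} \<or> B \<inter> frontier (A \<union> B) = {}"
    using connected_closedD[of "frontier (A \<union> B)" A B] empty A(1) B(1)
    by (auto simp: compact_imp_closed Int_commute Int_left_commute)
  then have "frontier (A \<union> B) \<subseteq> A \<or> frontier (A \<union> B) \<subseteq> B"
    using \<open>frontier (A \<union> B) \<subseteq> A \<union> B\<close> by blast
  then show False
    using subset_if_frontier_Un_subset[OF A B(1)] subset_if_frontier_Un_subset[OF B A(1)] AB(2,3)
    by (auto simp: Un_commute)
qed

text \<open>The other members are closed and miss a common point of \<open>A\<close> and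
  \<open>B\<close>, so near it the whole union is \<open>A \<union> B\<close>, and a frontier point
  of the latter is a vertex. A vertex serving two pairs would lie in three members.\<close>

lemma binomial_le_union_vertices:
  fixes G :: "point set set"
  assumes fin: "finite G" and k: "card G \<ge> 3"
    and cc: "\<And>A. A \<in> G \<Longrightarrow> compact A \<and> convex A"
    and meet: "\<And>A B. A \<in> G \<Longrightarrow> B \<in> G \<Longrightarrow> A \<inter> B \<noteq> {}"
    and no3: "\<And>A B C. \<lbrakk>A \<in> G; B \<in> G; C \<in> G; A \<noteq> B; A \<noteq> C; B \<noteq> C\<rbrakk> \<Longrightarrow> A \<inter> B \<inter> C = {}"
    and finv: "finite (union_vertices G)"
  shows "card G choose 2 \<le> card (union_vertices G)"
proof -
  have nsub: "\<not> A \<subseteq> B" if AB: "A \<in> G" "B \<in> G" "A \<noteq> B" for A B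
  proof
    assume "A \<subseteq> B"
    \<comment> \<open>A third member \<open>C\<close> exists; it meets \<open>A\<close> inside
      \<open>B\<close>, which is a forbidden triple point.\<close>
    have "card {A, B} < card G" using k AB by simp
    then have "\<not> G \<subseteq> {A, B}" using card_mono[of "{A,B}" G] by auto
    then obtain C where "C \<in> G" "C \<noteq> A" "C \<noteq> B" by blast
    then show False using no3[of A B C] meet[of A C] AB \<open>A \<subseteq> B\<close> by blast
  qed
  have ex: "\<exists>x. x \<in> A \<and> x \<in> B \<and> x \<in> union_vertices G" if AB: "A \<in> G" "B \<in> G" "A \<noteq> B" for A B
  proof -
    obtain x where x: "x \<in> A" "x \<in> B" "x \<in> frontier (A \<union> B)"
      using convex_pair_meets_frontier_Un[of A B] cc[of A] cc[of B] meet[of A B] AB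
        nsub[of A B] nsub[of B A] by auto
    define U where "U = - \<Union>(G - {A, B})"
    have "closed (\<Union>(G - {A, B}))"
      using fin cc by (intro closed_Union) (auto simp: compact_imp_closed)
    then have oU: "open U" unfolding U_def by blast
    have xU: "x \<in> U" unfolding U_def
    proof
      assume "x \<in> \<Union>(G - {A, B})"
      then obtain C where "C \<in> G" "C \<noteq> A" "C \<noteq> B" "x \<in> C" by blast
      then show False using no3[of A B C] AB x by blast
    qed
    have nint: "x \<notin> interior S" if "S \<inter> U \<subseteq> A \<union> B" for S
    proof
      assume "x \<in> interior S"
      then have "x \<in> interior (S \<inter> U)" using xU oU by (simp add: interior_Int interior_open)
      then have "x \<in> interior (A \<union> B)" using that interior_mono by blast
      then show False using x(3) by (simp add: frontier_def)
    qed
    have fr: "x \<in> frontier S" if "x \<in> S" "S \<inter> U \<subseteq> A \<union> B" for S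
      using that nint closure_subset by (auto simp: frontier_def)
    have "x \<in> frontier A" "x \<in> frontier B" "x \<in> frontier (\<Union>G)"
      using x AB by (auto intro!: fr simp: U_def)
    then show ?thesis using x AB unfolding union_vertices_def by blast
  qed
  define v where "v e = (SOME x. x \<in> \<Inter>e \<and> x \<in> union_vertices G)" for e
  let ?E = "{e. e \<subseteq> G \<and> card e = 2}"
  have v: "v e \<in> \<Inter>e \<and> v e \<in> union_vertices G" if "e \<in> ?E" for e
  proof -
    obtain A B where e: "e = {A, B}" "A \<noteq> B" using \<open>e \<in> ?E\<close> by (auto simp: card_2_iff)
    then have "\<exists>x. x \<in> \<Inter>e \<and> x \<in> union_vertices G" using ex[of A B] \<open>e \<in> ?E\<close> by simp
    then show ?thesis unfolding v_def by (rule someI_ex)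
  qed
  have "inj_on v ?E"
  proof (rule inj_onI, rule ccontr)
    fix e f assume ef: "e \<in> ?E" "f \<in> ?E" "v e = v f" "e \<noteq> f"
    obtain A B where e: "e = {A, B}" "A \<noteq> B" using ef(1) by (auto simp: card_2_iff)
    have "finite e" using e by simp
    have "\<not> f \<subseteq> e" using ef card_subset_eq[OF \<open>finite e\<close>, of f] by auto
    then obtain C where "C \<in> f" "C \<notin> e" by blast
    moreover have "v e \<in> A \<inter> B \<inter> C"
      using v[OF ef(1)] v[OF ef(2)] ef(3) e(1) \<open>C \<in> f\<close> by simp
    ultimately show False using no3[of A B C] ef(1,2) e by blast
  qed
  moreover have "v ` ?E \<subseteq> union_vertices G" using v by blast
  ultimately have "card ?E \<le> card (union_vertices G)" using finv card_inj_on_le by blast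
  then show ?thesis using n_subsets[OF fin, of 2] by simp
qed

section \<open>Four orders on disjoint convex sets\<close>

text \<open>Mirsky's argument: the minimal elements form an antichain. If there are fewer than
  \<open>m\<close>, removing them leaves at least \<open>m * p\<close> elements, and a chain found
  there extends downwards because its first element was not minimal.\<close>

lemma chain_or_antichain:
  fixes S :: "'a set"
  assumes "transp r" "irreflp r" "finite S" "card S \<ge> m * p"
  shows "(\<exists>xs. sorted_wrt r xs \<and> length xs = p \<and> set xs \<subseteq> S) \<or>
    (\<exists>T\<subseteq>S. card T = m \<and> (\<forall>x\<in>T. \<forall>y\<in>T. \<not> r x y))"
  using assms(3,4)
proof (induction p arbitrary: S)
  case 0
  then show ?case by (intro disjI1 exI[of _ "[]"]) auto
next
  case (Suc p)
  define M where "M = {x \<in> S. \<forall>y\<in>S. \<not> r y x}"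
  have MS: "M \<subseteq> S" "finite M" using Suc.prems(1) by (auto simp: M_def)
  show ?case
  proof (cases "card M \<ge> m")
    case True
    then obtain T where "T \<subseteq> M" "card T = m" by (meson obtain_subset_with_card_n)
    then show ?thesis by (intro disjI2 exI[of _ T]) (auto simp: M_def)
  next
    case False
    have "card (S - M) = card S - card M" using MS card_Diff_subset by blast
    then have "m * p \<le> card (S - M)" using Suc.prems(2) False by simp
    from Suc.IH[OF _ this] Suc.prems(1)
    consider (c) xs where "sorted_wrt r xs" "length xs = p" "set xs \<subseteq> S - M"
      | (a) T where "T \<subseteq> S - M" "card T = m" "\<forall>x\<in>T. \<forall>y\<in>T. \<not> r x y" by auto
    then show ?thesis
    proof cases
      case c
      have "\<exists>y\<in>S. \<forall>x\<in>set xs. r y x"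
      proof (cases xs)
        case Nil
        have "card S \<noteq> 0" using Suc.prems(2) False by simp
        then show ?thesis using Nil by (auto simp: card_gt_0_iff)
      next
        case (Cons z zs)
        then obtain y where "y \<in> S" "r y z" using c(3) by (auto simp: M_def)
        then show ?thesis using Cons c(1) transpD[OF assms(1)] by auto
      qed
      then obtain y where "y \<in> S" "\<forall>x\<in>set xs. r y x" by blast
      then show ?thesis using c by (intro disjI1 exI[of _ "y # xs"]) auto
    next
      case a
      then show ?thesis by blast
    qed
  qed
qed

lemma sorted_wrt_irreflp_imp_distinct: "irreflp r \<Longrightarrow> sorted_wrt r xs \<Longrightarrow> distinct xs"
  by (induction xs) (auto dest: irreflpD)

text \<open>Two disjoint convex bodies are comparable in one of four orders: the projections to the first axis are
  either shifted or nested, and on common vertical lines one body lies below the other.\<close>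

definition vert_below :: "point set \<Rightarrow> point set \<Rightarrow> bool" where
  "vert_below A B \<longleftrightarrow> (\<forall>a\<in>A. \<forall>b\<in>B. a $ 1 = b $ 1 \<longrightarrow> a $ 2 < b $ 2)"

definition proj_left :: "point set \<Rightarrow> real" where "proj_left A = Inf ((\<lambda>x. x $ 1) ` A)"
definition proj_right :: "point set \<Rightarrow> real" where "proj_right A = Sup ((\<lambda>x. x $ 1) ` A)"

definition shifted :: "point set \<Rightarrow> point set \<Rightarrow> bool" where
  "shifted A B \<longleftrightarrow> proj_left A \<le> proj_left B \<and> proj_right A \<le> proj_right B"

definition nested :: "point set \<Rightarrow> point set \<Rightarrow> bool" where
  "nested A B \<longleftrightarrow> proj_left B \<le> proj_left A \<and> proj_right A \<le> proj_right B"

lemma projection_eq_interval: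
  fixes A :: "point set"
  assumes "compact A" "convex A" "A \<noteq> {}"
  shows "(\<lambda>x. x $ 1) ` A = {proj_left A .. proj_right A}"
proof -
  have "compact ((\<lambda>x. x $ 1) ` A)" using assms(1)
    by (intro compact_continuous_image continuous_intros)
  moreover have "connected ((\<lambda>x. x $ 1) ` A)" using assms(2)
    by (intro connected_continuous_image continuous_intros convex_connected)
  ultimately obtain a b where ab: "(\<lambda>x. x $ 1) ` A = {a..b}"
    by (metis connected_compact_interval_1)
  moreover have "a \<le> b" using ab assms(3) by (metis atLeastatMost_empty_iff2 image_is_empty)
  ultimately show ?thesis by (simp add: proj_left_def proj_right_def)
qed

definition convex_body :: "point set \<Rightarrow> bool" where
  "convex_body A \<longleftrightarrow> compact A \<and> convex A \<and> A \<noteq> {}"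

text \<open>Alone, \<open>vert_below\<close> is not transitive: \<open>A\<close> and
  \<open>C\<close> may share a vertical line that misses \<open>B\<close>. In each of the four
  patterns the projection of \<open>B\<close> contains the common part of the projections of
  \<open>A\<close> and \<open>C\<close>.\<close>

lemma vert_below_trans:
  assumes "convex_body A" "convex_body B" "convex_body C" "vert_below A B" "vert_below B C"
    "shifted A B \<and> shifted B C \<or> shifted B A \<and> shifted C B \<or>
     nested A B \<and> nested B C \<or> nested B A \<and> nested C B"
  shows "vert_below A C"
  unfolding vert_below_def
proof (intro ballI impI)
  fix a c assume ac: "a \<in> A" "c \<in> C" "a $ 1 = c $ 1"
  have "a $ 1 \<in> (\<lambda>x. x $ 1) ` A" using ac(1) by (rule imageI)
  moreover have "a $ 1 \<in> (\<lambda>x. x $ 1) ` C" unfolding ac(3) using ac(2) by (rule imageI)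
  ultimately have "a $ 1 \<in> (\<lambda>x. x $ 1) ` B"
    using assms unfolding convex_body_def shifted_def nested_def
    by (auto simp: projection_eq_interval simp del: image_iff)
  then obtain b where "b \<in> B" "b $ 1 = a $ 1" by auto
  then have "a $ 2 < b $ 2" "b $ 2 < c $ 2" using assms(4,5) ac unfolding vert_below_def by auto
  then show "a $ 2 < c $ 2" by simp
qed

text \<open>The four orders are the choices of \<open>R\<close> among \<open>shifted\<close> and
  \<open>nested\<close> and of \<open>up\<close>. Both choices of \<open>R\<close> are mere
  preorders; strictness comes from \<open>vert_below\<close>, and building in
  \<open>convex_body\<close> makes transitivity unconditional.\<close>

definition strip_order :: "(point set \<Rightarrow> point set \<Rightarrow> bool) \<Rightarrow> bool \<Rightarrow> point set \<Rightarrow> point set \<Rightarrow> bool" where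
  "strip_order R up A B \<longleftrightarrow> convex_body A \<and> convex_body B \<and> R A B \<and> (if up then vert_below A B else vert_below B A)"

lemma strip_order_transp:
  assumes "R = shifted \<or> R = nested"
  shows "transp (strip_order R up)"
proof (rule transpI)
  fix A B C assume *: "strip_order R up A B" "strip_order R up B C"
  then have b: "convex_body A" "convex_body B" "convex_body C" and R: "R A B" "R B C" by (auto simp: strip_order_def)
  have "R A C" using R assms by (auto simp: shifted_def nested_def)
  moreover have "if up then vert_below A C else vert_below C A"
    using * vert_below_trans[OF b] vert_below_trans[OF b(3,2,1)] assms R
    by (cases up) (auto simp: strip_order_def)
  ultimately show "strip_order R up A C" using b by (simp add: strip_order_def)
qed

lemma vert_below_disjoint: "vert_below A B \<Longrightarrow> A \<inter> B = {}"
  by (auto simp: vert_below_def)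

lemma strip_order_disjoint: "strip_order R up A B \<Longrightarrow> A \<inter> B = {}"
  by (auto simp: strip_order_def split: if_splits dest: vert_below_disjoint)

lemma strip_order_irreflp: "irreflp (strip_order R up)"
proof (rule irreflpI)
  show "\<not> strip_order R up A A" for A
    using strip_order_disjoint[of R up A A] by (auto simp: strip_order_def convex_body_def)
qed

text \<open>On a common vertical line a separating functional sees only its second coefficient,
  whose sign fixes the order. If that coefficient vanishes, there is no common vertical line and
  both orders hold vacuously.\<close>

lemma disjoint_vert_comparable:
  fixes A B :: "point set"
  assumes A: "convex_body A" and B: "convex_body B" and "A \<inter> B = {}"
  shows "vert_below A B \<or> vert_below B A"
proof -
  obtain u t where ut: "\<forall>x\<in>A. inner u x < t" "\<forall>x\<in>B. inner u x > t"
    using separating_hyperplane_closed_compact[of A B] assms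
    unfolding convex_body_def by (auto simp: compact_imp_closed)
  have *: "u $ 2 * (b $ 2 - a $ 2) > 0" if "a \<in> A" "b \<in> B" "a $ 1 = b $ 1" for a b
  proof -
    have "inner u a < inner u b" using ut that by force
    then show ?thesis using that(3) by (simp add: inner_vec_def sum_2 algebra_simps)
  qed
  show ?thesis
  proof (cases "u $ 2 > 0")
    case True
    then have "vert_below A B" unfolding vert_below_def using * by (auto simp: zero_less_mult_iff)
    then show ?thesis ..
  next
    case False
    then have "vert_below B A" unfolding vert_below_def using *
      by (metis diff_gt_0_iff_gt diff_less_0_iff_less zero_less_mult_iff)
    then show ?thesis ..
  qed
qed

lemma disjoint_imp_strip_order:
  assumes "convex_body A" "convex_body B" "A \<inter> B = {}"
  shows "\<exists>R\<in>{shifted, nested}. \<exists>up. strip_order R up A B \<or> strip_order R up B A"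
proof -
  have "shifted A B \<or> shifted B A \<or> nested A B \<or> nested B A"
    unfolding shifted_def nested_def by linarith
  moreover have "\<exists>up. strip_order R up A B \<or> strip_order R up B A" if "R A B \<or> R B A" for R
    using disjoint_vert_comparable[OF assms] that assms(1,2) unfolding strip_order_def by metis
  ultimately show ?thesis by simp metis
qed

text \<open>Chains consist of pairwise disjoint sets, so none has \<open>p\<close> members, and
  passing to an antichain of one order costs a factor \<open>p\<close>. A disjoint pair surviving
  all four passes would be comparable in one of the orders.\<close>

lemma no_p_disjoint_imp_pairwise_meeting:
  fixes S :: "point set set"
  assumes fin: "finite S" and card: "card S = k * p ^ 4"
    and cc: "\<And>A. A \<in> S \<Longrightarrow> convex_body A"
    and meet: "\<And>Q. Q \<subseteq> S \<Longrightarrow> card Q = p \<Longrightarrow> \<exists>A\<in>Q. \<exists>B\<in>Q. A \<noteq> B \<and> A \<inter> B \<noteq> {}"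
  shows "\<exists>T\<subseteq>S. card T = k \<and> (\<forall>A\<in>T. \<forall>B\<in>T. A \<inter> B \<noteq> {})"
proof -
  have step: "\<exists>T\<subseteq>U. card T = m \<and> (\<forall>A\<in>T. \<forall>B\<in>T. \<not> strip_order R up A B)"
    if U: "U \<subseteq> S" "card U = m * p" and R: "R = shifted \<or> R = nested" for U m R up
  proof -
    have nochain: False if xs: "sorted_wrt (strip_order R up) xs" "length xs = p" "set xs \<subseteq> U" for xs
    proof -
      have "distinct xs" using sorted_wrt_irreflp_imp_distinct[OF strip_order_irreflp xs(1)] .
      then have "card (set xs) = p" using xs(2) distinct_card by blast
      then obtain A B where AB: "A \<in> set xs" "B \<in> set xs" "A \<noteq> B" "A \<inter> B \<noteq> {}"
        using meet[of "set xs"] xs(3) U by blast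
      then obtain i j where ij: "i < length xs" "j < length xs" "xs ! i = A" "xs ! j = B"
        by (meson in_set_conv_nth)
      then have "i < j \<or> j < i" using AB(3) by (metis nat_neq_iff)
      then have "strip_order R up A B \<or> strip_order R up B A"
        using sorted_wrt_nth_less[OF xs(1)] ij by blast
      then show False using strip_order_disjoint AB(4) by blast
    qed
    show ?thesis
      using chain_or_antichain[OF strip_order_transp[OF R, of up] strip_order_irreflp, of U m p]
        U fin finite_subset nochain by (metis order_refl)
  qed
  obtain T1 where T1: "T1 \<subseteq> S" "card T1 = k * p ^ 3"
      "\<forall>A\<in>T1. \<forall>B\<in>T1. \<not> strip_order shifted True A B"
    using step[of S "k * p ^ 3" shifted True] card by (auto simp: power_numeral_reduce mult_ac)
  obtain T2 where T2: "T2 \<subseteq> T1" "card T2 = k * p ^ 2"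
      "\<forall>A\<in>T2. \<forall>B\<in>T2. \<not> strip_order shifted False A B"
    using step[of T1 "k * p ^ 2" shifted False] T1 by (auto simp: power_numeral_reduce mult_ac)
  obtain T3 where T3: "T3 \<subseteq> T2" "card T3 = k * p"
      "\<forall>A\<in>T3. \<forall>B\<in>T3. \<not> strip_order nested True A B"
    using step[of T2 "k * p" nested True] subset_trans[OF T2(1) T1(1)] T2(2)
    by (auto simp: power_numeral_reduce mult_ac)
  obtain T where T: "T \<subseteq> T3" "card T = k"
      "\<forall>A\<in>T. \<forall>B\<in>T. \<not> strip_order nested False A B"
    using step[of T3 k nested False] subset_trans[OF T3(1) subset_trans[OF T2(1) T1(1)]] T3(2)
    by auto
  have "A \<inter> B \<noteq> {}" if "A \<in> T" "B \<in> T" for A B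
  proof
    assume "A \<inter> B = {}"
    have mem: "A \<in> T1" "A \<in> T2" "A \<in> T3" "B \<in> T1" "B \<in> T2" "B \<in> T3"
      using that T(1) T3(1) T2(1) by auto
    then have "convex_body A" "convex_body B" using T1(1) cc by auto
    from disjoint_imp_strip_order[OF this \<open>A \<inter> B = {}\<close>]
    obtain R up where "R = shifted \<or> R = nested" "strip_order R up A B \<or> strip_order R up B A"
      by auto
    then show False using that mem T(3) T3(3) T2(3) T1(3) by (cases up) auto
  qed
  then show ?thesis using T T3 T2 T1 by (intro exI[of _ T]) auto
qed

lemma three_members_meet:
  assumes p: "p \<ge> 2" and k: "k \<ge> 3"
    and cc: "\<forall>A\<in>F. compact A \<and> convex A"
    and pq: "pq_property p 2 F"
    and uc: "\<forall>G\<subseteq>F. finite G \<and> card G = k \<longrightarrow> union_complexity_less G (k choose 2)"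
    and S: "S \<subseteq> F" "finite S" "card S = k * p ^ 4"
  shows "\<exists>A\<in>S. \<exists>B\<in>S. \<exists>C\<in>S. A \<noteq> B \<and> A \<noteq> C \<and> B \<noteq> C \<and> A \<inter> B \<inter> C \<noteq> {}"
proof (rule ccontr)
  assume no: "\<not> ?thesis"
  have bodies: "convex_body A" if "A \<in> F" for A
    using that cc pq by (auto simp: convex_body_def pq_property_def)
  have "\<exists>A\<in>Q. \<exists>B\<in>Q. A \<noteq> B \<and> A \<inter> B \<noteq> {}" if Q: "Q \<subseteq> S" "card Q = p" for Q
  proof -
    have "Q \<subseteq> F \<and> finite Q \<and> card Q = p" using Q S finite_subset by blast
    then obtain Q' where Q': "Q' \<subseteq> Q" "card Q' = 2" "\<Inter>Q' \<noteq> {}"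
      using pq unfolding pq_property_def by blast
    from Q'(2) obtain A B where AB: "Q' = {A, B}" "A \<noteq> B" by (auto simp: card_2_iff)
    have "A \<in> Q" "B \<in> Q" "A \<inter> B \<noteq> {}" using Q'(1,3) unfolding AB(1) by simp_all
    then show ?thesis using AB(2) by blast
  qed
  then obtain T where T: "T \<subseteq> S" "card T = k" "\<forall>A\<in>T. \<forall>B\<in>T. A \<inter> B \<noteq> {}"
    using no_p_disjoint_imp_pairwise_meeting[OF S(2,3) bodies[OF subsetD[OF S(1)]]] by metis
  have finT: "finite T" using T(1) S(2) finite_subset by blast
  have ucT: "union_complexity_less T (k choose 2)" using uc T S finT by blast
  have "card T choose 2 \<le> card (union_vertices T)"
  proof (rule binomial_le_union_vertices)
    show "A \<inter> B \<inter> C = {}" if "A \<in> T" "B \<in> T" "C \<in> T" "A \<noteq> B" "A \<noteq> C" "B \<noteq> C" for A B C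
      using no that T(1) by blast
  qed (use T S k finT ucT cc in \<open>auto simp: union_complexity_less_def\<close>)
  then show False using ucT T(2) by (simp add: union_complexity_less_def)
qed

section \<open>Fractional Helly from random sampling\<close>

text \<open>Each vertex beyond the first \<open>N\<close> pays for one edge: deleting a vertex of
  some edge loses that edge, while the hypothesis survives on the rest.\<close>

lemma card_edges_in_dense_hypergraph:
  fixes V :: "'a set" and E :: "'a set set"
  assumes "finite V" "card V = N + t" "finite E" "{} \<notin> E"
    and "\<And>U. U \<subseteq> V \<Longrightarrow> card U = N \<Longrightarrow> \<exists>e\<in>E. e \<subseteq> U"
  shows "card {e \<in> E. e \<subseteq> V} \<ge> t + 1"
  using assms(1,2,5)
proof (induction t arbitrary: V)
  case 0
  then obtain e where "e \<in> E" "e \<subseteq> V" by auto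
  then have "{e \<in> E. e \<subseteq> V} \<noteq> {}" by blast
  then show ?case using assms(3) by (simp add: card_gt_0_iff Suc_le_eq)
next
  case (Suc t)
  obtain U where "U \<subseteq> V" "card U = N" using Suc.prems(2) obtain_subset_with_card_n
    by (metis le_add1)
  then obtain e where e: "e \<in> E" "e \<subseteq> V" using Suc.prems(3) by blast
  then obtain v where v: "v \<in> e" using assms(4) by (metis ex_in_conv)
  have "card (V - {v}) = N + t" using Suc.prems(1,2) e v by auto
  then have IH: "t + 1 \<le> card {e \<in> E. e \<subseteq> V - {v}}"
    using Suc.prems by (intro Suc.IH) auto
  have "{e \<in> E. e \<subseteq> V - {v}} \<subset> {e \<in> E. e \<subseteq> V}" using e v by auto
  then have "card {e \<in> E. e \<subseteq> V - {v}} < card {e \<in> E. e \<subseteq> V}"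
    using assms(3) by (intro psubset_card_mono) auto
  then show ?case using IH by simp
qed

lemma sum_PiE_insert:
  fixes w :: "'b \<Rightarrow> real"
  assumes "finite J" "a \<notin> J" "finite I"
  shows "(\<Sum>f\<in>PiE (insert a J) (\<lambda>_. I). (\<Prod>i\<in>insert a J. w (f i)) * h f) =
    (\<Sum>x\<in>I. w x * (\<Sum>f\<in>PiE J (\<lambda>_. I). (\<Prod>i\<in>J. w (f i)) * h (f(a := x))))"
proof -
  have pr: "(\<Prod>i\<in>J. w (if i = a then x else f i)) = (\<Prod>i\<in>J. w (f i))" for f x
    using assms(2) by (intro prod.cong) auto
  have "(\<Sum>f\<in>PiE (insert a J) (\<lambda>_. I). (\<Prod>i\<in>insert a J. w (f i)) * h f) =
    (\<Sum>(x, f)\<in>I \<times> PiE J (\<lambda>_. I). w x * ((\<Prod>i\<in>J. w (f i)) * h (f(a := x))))"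
    unfolding PiE_insert_eq using assms
    by (subst sum.reindex[OF inj_combinator[OF assms(2)]])
      (simp add: case_prod_unfold pr mult.assoc)
  also have "\<dots> = (\<Sum>x\<in>I. \<Sum>f\<in>PiE J (\<lambda>_. I). w x * ((\<Prod>i\<in>J. w (f i)) * h (f(a := x))))"
    by (rule sum.cartesian_product[symmetric])
  finally show ?thesis by (simp add: sum_distrib_left)
qed

text \<open>Fubini for the unnormalised product measure: each coordinate that \<open>g\<close> does
  not read contributes the total weight.\<close>

lemma sum_PiE_triple_marginal:
  fixes w :: "'b \<Rightarrow> real"
  assumes J: "finite J" "a \<notin> J" "b \<notin> J" "c \<notin> J" "a \<noteq> b" "a \<noteq> c" "b \<noteq> c" and I: "finite I"
  shows "(\<Sum>f\<in>PiE (insert a (insert b (insert c J))) (\<lambda>_. I).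
      (\<Prod>i\<in>insert a (insert b (insert c J)). w (f i)) * g (f a) (f b) (f c)) =
    (\<Sum>x\<in>I. w x)^card J * (\<Sum>x\<in>I. \<Sum>y\<in>I. \<Sum>z\<in>I. w x * w y * w z * g x y z)"
proof -
  have "(\<Sum>f\<in>PiE (insert a (insert b (insert c J))) (\<lambda>_. I).
      (\<Prod>i\<in>insert a (insert b (insert c J)). w (f i)) * g (f a) (f b) (f c)) =
     (\<Sum>x\<in>I. w x * (\<Sum>y\<in>I. w y * (\<Sum>z\<in>I. w z * 
       (\<Sum>f\<in>PiE J (\<lambda>_. I). (\<Prod>i\<in>J. w (f i)) * g x y z))))"
  proof -
    have 1: "a \<notin> insert b (insert c J)" "finite (insert b (insert c J))"
      and 2: "b \<notin> insert c J" "finite (insert c J)" using assms by auto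
    have "(\<Sum>f\<in>PiE (insert c J) (\<lambda>_. I). (\<Prod>i\<in>insert c J. w (f i)) * g x y (f c)) =
        (\<Sum>z\<in>I. w z * (\<Sum>f\<in>PiE J (\<lambda>_. I). (\<Prod>i\<in>J. w (f i)) * g x y z))" for x y
      using sum_PiE_insert[OF J(1) J(4) I, of w "\<lambda>f. g x y (f c)"] by (simp only: fun_upd_same)
    moreover have "(\<Sum>f\<in>PiE (insert b (insert c J)) (\<lambda>_. I).
          (\<Prod>i\<in>insert b (insert c J). w (f i)) * g x (f b) (f c)) =
        (\<Sum>y\<in>I. w y * (\<Sum>f\<in>PiE (insert c J) (\<lambda>_. I). (\<Prod>i\<in>insert c J. w (f i)) * g x y (f c)))" for x
      using sum_PiE_insert[OF 2(2) 2(1) I, of w "\<lambda>f. g x (f b) (f c)"] 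
      by (simp only: fun_upd_same fun_upd_other[OF J(7)[symmetric]])
    ultimately show ?thesis
      using sum_PiE_insert[OF 1(2) 1(1) I, of w "\<lambda>f. g (f a) (f b) (f c)"]
      by (simp only: fun_upd_same fun_upd_other[OF J(5)[symmetric]] fun_upd_other[OF J(6)[symmetric]])
  qed
  also have "\<dots> = (\<Sum>x\<in>I. \<Sum>y\<in>I. \<Sum>z\<in>I.
      (\<Sum>f\<in>PiE J (\<lambda>_. I). (\<Prod>i\<in>J. w (f i))) * (w x * w y * w z * g x y z))"
    by (simp add: sum_distrib_left sum_distrib_right mult_ac)
  also have "(\<Sum>f\<in>PiE J (\<lambda>_. I). (\<Prod>i\<in>J. w (f i))) = (\<Sum>x\<in>I. w x)^card J"
    using prod_sum_PiE[of J "\<lambda>_. I" "\<lambda>_. w"] J(1) I by simp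
  finally show ?thesis by (simp add: sum_distrib_left)
qed

text \<open>Sample \<open>4P\<close> members independently: any \<open>2P\<close> of the samples contain either one member three
  times or \<open>P\<close> distinct ones, so every sample has at least \<open>2P\<close> meeting triples.\<close>

lemma weighted_meeting_triples:
  fixes I :: "'a set set" and w :: "'a set \<Rightarrow> real"
  assumes I: "finite I" "{} \<notin> I" and w: "\<And>A. A \<in> I \<Longrightarrow> w A \<ge> 0" and P: "P > 0"
    and meet: "\<And>S. S \<subseteq> I \<Longrightarrow> card S = P \<Longrightarrow>
      \<exists>A\<in>S. \<exists>B\<in>S. \<exists>C\<in>S. A \<noteq> B \<and> A \<noteq> C \<and> B \<noteq> C \<and> A \<inter> B \<inter> C \<noteq> {}"
  shows "3 * (\<Sum>A\<in>I. w A) ^ 3 \<le>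
    16 * real P ^ 2 * (\<Sum>A\<in>I. \<Sum>B\<in>I. \<Sum>C\<in>I. w A * w B * w C * of_bool (A \<inter> B \<inter> C \<noteq> {}))"
    (is "_ \<le> _ * ?S")
proof -
  \<comment> \<open>\<open>2 * P\<close> indices force one meeting triple, and each of the other
    \<open>2 * P\<close> forces one more.\<close>
  define M where "M = 4 * P"
  define W where "W = (\<Sum>A\<in>I. w A)"
  let ?T = "{e. e \<subseteq> {..<M} \<and> card e = 3}"
  let ?X = "PiE {..<M} (\<lambda>_. I)"
  have finT: "finite ?T" by simp
  have W0: "W \<ge> 0" unfolding W_def using w by (simp add: sum_nonneg)
  have triple: "\<exists>e\<in>?T. e \<subseteq> U \<and> (\<Inter>i\<in>e. f i) \<noteq> {}"
    if f: "f \<in> ?X" and U: "U \<subseteq> {..<M}" "card U = 2 * P" for f U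
  proof (cases "\<exists>A. card {i \<in> U. f i = A} \<ge> 3")
    case True
    then obtain A e where e: "e \<subseteq> {i \<in> U. f i = A}" "card e = 3"
      by (meson obtain_subset_with_card_n)
    then have "e \<noteq> {}" by auto
    then obtain i where "i \<in> e" by blast
    then have "A \<in> I" using e(1) U(1) f by (auto simp: PiE_iff)
    moreover have "(\<Inter>i\<in>e. f i) = A" using e(1) \<open>i \<in> e\<close> by auto
    ultimately show ?thesis using e U I(2) by (intro bexI[of _ e]) auto
  next
    case False
    have finU: "finite U" using U(1) finite_subset by blast
    have "U = (\<Union>A\<in>f ` U. {i \<in> U. f i = A})" by auto
    then have "card U \<le> (\<Sum>A\<in>f ` U. card {i \<in> U. f i = A})"
      using card_UN_le[of "f ` U" "\<lambda>A. {i \<in> U. f i = A}"] finU by simp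
    also have "\<dots> \<le> (\<Sum>A\<in>f ` U. 2)" using False by (intro sum_mono) (metis not_less_eq_eq numeral_2_eq_2 numeral_3_eq_3)
    finally have "P \<le> card (f ` U)" using U(2) by simp
    then obtain S where S: "S \<subseteq> f ` U" "card S = P" by (meson obtain_subset_with_card_n)
    moreover have "f ` U \<subseteq> I" using U(1) f by (auto simp: PiE_iff)
    ultimately obtain A B C where ABC: "A \<in> S" "B \<in> S" "C \<in> S" "A \<noteq> B" "A \<noteq> C" "B \<noteq> C"
      "A \<inter> B \<inter> C \<noteq> {}" using meet[OF subset_trans[OF S(1)] S(2)] by metis
    obtain a b c where abc: "a \<in> U" "b \<in> U" "c \<in> U" "f a = A" "f b = B" "f c = C"
      using subsetD[OF S(1) ABC(1)] subsetD[OF S(1) ABC(2)] subsetD[OF S(1) ABC(3)]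
      by (elim imageE) metis
    have "a \<noteq> b" "a \<noteq> c" "b \<noteq> c" using abc(4-6) ABC(4-6) by auto
    then have "card {a, b, c} = 3" by simp
    moreover have "(\<Inter>i\<in>{a, b, c}. f i) \<noteq> {}" using abc(4-6) ABC(7) by (simp add: Int_assoc)
    moreover have "{a, b, c} \<subseteq> U" using abc by simp
    ultimately show ?thesis using U(1) by (intro bexI[of _ "{a, b, c}"]) auto
  qed
  have count: "2 * real P \<le> (\<Sum>e\<in>?T. of_bool ((\<Inter>i\<in>e. f i) \<noteq> {}))" if "f \<in> ?X" for f
  proof -
    let ?E = "{e \<in> ?T. (\<Inter>i\<in>e. f i) \<noteq> {}}"
    have "2 * P + 1 \<le> card {e \<in> ?E. e \<subseteq> {..<M}}"
    proof (rule card_edges_in_dense_hypergraph)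
      show "\<exists>e\<in>?E. e \<subseteq> U" if "U \<subseteq> {..<M}" "card U = 2 * P" for U
        using triple[OF \<open>f \<in> ?X\<close> that] by auto
    qed (auto simp: M_def)
    also have "{e \<in> ?E. e \<subseteq> {..<M}} = ?E" by auto
    finally have "2 * real P \<le> real (card ?E)" by linarith
    also have "\<dots> = (\<Sum>e\<in>?T. of_bool ((\<Inter>i\<in>e. f i) \<noteq> {}))"
      using finT by (simp add: of_bool_def sum.If_cases Int_def)
    finally show ?thesis .
  qed
  \<comment> \<open>The weighted frequency of meeting is the same for all index triples. Sampling is
    with replacement, so \<open>?S\<close> runs over ordered triples with repetition.\<close>
  have marg: "(\<Sum>f\<in>?X. (\<Prod>i<M. w (f i)) * of_bool ((\<Inter>i\<in>e. f i) \<noteq> {})) = W ^ (M - 3) * ?S"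
    if eT: "e \<in> ?T" for e
  proof -
    obtain a b c where e: "e = {a, b, c}" "a \<noteq> b" "a \<noteq> c" "b \<noteq> c"
      using eT card_3_iff[of e] by auto
    define J where "J = {..<M} - {a, b, c}"
    have "{..<M} = insert a (insert b (insert c J))" using e that by (auto simp: J_def)
    moreover have "card J = M - 3" using e that by (simp add: J_def card_Diff_subset)
    moreover have "a \<notin> J" "b \<notin> J" "c \<notin> J" "finite J" by (auto simp: J_def)
    ultimately show ?thesis
      using sum_PiE_triple_marginal[of J a b c I w "\<lambda>A B C. of_bool (A \<inter> B \<inter> C \<noteq> {})"] e I
      by (simp add: W_def Int_assoc)
  qed
  have "W ^ M = (\<Sum>f\<in>?X. (\<Prod>i<M. w (f i)))"
    using prod_sum_PiE[of "{..<M}" "\<lambda>_. I" "\<lambda>_. w"] I by (simp add: W_def)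
  then have "2 * real P * W ^ M = (\<Sum>f\<in>?X. (\<Prod>i<M. w (f i)) * (2 * real P))"
    by (simp add: sum_distrib_left mult_ac)
  also have "\<dots> \<le> (\<Sum>f\<in>?X. (\<Prod>i<M. w (f i)) * (\<Sum>e\<in>?T. of_bool ((\<Inter>i\<in>e. f i) \<noteq> {})))"
    using w by (intro sum_mono mult_left_mono count prod_nonneg) (auto simp: PiE_iff)
  also have "\<dots> = (\<Sum>e\<in>?T. \<Sum>f\<in>?X. (\<Prod>i<M. w (f i)) * of_bool ((\<Inter>i\<in>e. f i) \<noteq> {}))"
    unfolding sum_distrib_left by (rule sum.swap)
  also have "\<dots> = real (M choose 3) * (W ^ (M - 3) * ?S)"
    using marg n_subsets[of "{..<M}" 3] by simp
  finally have main: "2 * real P * W ^ M \<le> real (M choose 3) * (W ^ (M - 3) * ?S)" .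
  have S0: "?S \<ge> 0" using w by (intro sum_nonneg) auto
  show ?thesis
  proof (cases "W = 0")
    case True
    then show ?thesis using S0 by (simp add: W_def)
  next
    case False
    then have Wp: "W ^ (M - 3) > 0" using W0 by simp
    have "M \<ge> 3" using P by (simp add: M_def)
    then have "W ^ M = W ^ (M - 3) * W ^ 3" by (metis le_add_diff_inverse2 power_add)
    then have "W ^ (M - 3) * (2 * real P * W ^ 3) \<le> W ^ (M - 3) * (real (M choose 3) * ?S)"
      using main by (simp add: mult_ac)
    then have 1: "2 * real P * W ^ 3 \<le> real (M choose 3) * ?S" using Wp by simp
    \<comment> \<open>\<open>M choose 3\<close> is at most \<open>(4 * P) ^ 3 / 6\<close>; division
      by \<open>2 * P\<close> leaves the factor \<open>16 * P ^ 2 / 3\<close>.\<close>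
    have "6 * (M choose 3) \<le> M ^ 3"
      using binomial_fact_lemma[OF \<open>M \<ge> 3\<close>] binomial_fact_pow[of M 3]
      by (simp add: fact_numeral mult.commute)
    then have "6 * real (M choose 3) \<le> real M ^ 3" by (metis of_nat_le_iff of_nat_mult of_nat_numeral of_nat_power)
    then have "(6 * real (M choose 3)) * ?S \<le> (64 * real P ^ 3) * ?S"
      by (intro mult_right_mono[OF _ S0]) (simp add: M_def power_mult_distrib)
    then have "12 * real P * W ^ 3 \<le> 64 * real P ^ 3 * ?S" using 1 by linarith
    then have "4 * real P * (3 * W ^ 3) \<le> 4 * real P * (16 * real P ^ 2 * ?S)"
      by (simp add: power3_eq_cube power2_eq_square mult_ac)
    then show ?thesis using P by (simp add: W_def)
  qed
qed

section \<open>Lexicographic minima of intersections and fractional Helly\<close>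

definition lexless :: "point \<Rightarrow> point \<Rightarrow> bool" where
  "lexless x y \<longleftrightarrow> x $ 1 < y $ 1 \<or> x $ 1 = y $ 1 \<and> x $ 2 < y $ 2"

text \<open>The set is the open half-plane left of \<open>v\<close> together with an open downward
  ray on its boundary line. A linear functional alone could have many minimum points; the tie-break
  makes the minimum unique and keeps the lower set convex.\<close>

lemma convex_lexless: "convex {x. lexless x v}"
proof (rule convexI)
  fix x y :: point and s t :: real
  assume *: "x \<in> {x. lexless x v}" "y \<in> {x. lexless x v}" "0 \<le> s" "0 \<le> t" "s + t = 1"
  have t: "t = 1 - s" using * by simp
  have mix: "s * a + t * b < c" if "a \<le> c" "b \<le> c" "s > 0 \<longrightarrow> a < c" "t > 0 \<longrightarrow> b < c" for a b c :: real
  proof (cases "s > 0")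
    case True
    then have "s * a < s * c" "t * b \<le> t * c" using that *(4) by (auto intro: mult_left_mono)
    then have "s * a + t * b < (s + t) * c" unfolding distrib_right by linarith
    then show ?thesis using *(5) by simp
  next
    case False
    then show ?thesis using that * by simp
  qed
  have le: "x $ 1 \<le> v $ 1" "y $ 1 \<le> v $ 1" using * by (auto simp: lexless_def)
  show "s *\<^sub>R x + t *\<^sub>R y \<in> {x. lexless x v}"
  proof (cases "s * x $ 1 + t * y $ 1 < v $ 1")
    case True
    then show ?thesis by (simp add: lexless_def)
  next
    case False
    \<comment> \<open>The weighted deficits in the first coordinate are nonnegative with sum at most
      0, so both vanish and the second coordinate decides.\<close>
    define d e where "d = s * (v $ 1 - x $ 1)" and "e = t * (v $ 1 - y $ 1)"
    have "d \<ge> 0" "e \<ge> 0" using le *(3,4) by (simp_all add: d_def e_def)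
    moreover have "d + e = v $ 1 - (s * x $ 1 + t * y $ 1)"
      unfolding d_def e_def t by (simp add: algebra_simps)
    ultimately have "d = 0" "e = 0" and v1: "s * x $ 1 + t * y $ 1 = v $ 1" using False by linarith+
    then have eq: "s * (v $ 1 - x $ 1) = 0" "t * (v $ 1 - y $ 1) = 0" by (simp_all only: d_def e_def)
    have "s * x $ 2 + t * y $ 2 < v $ 2"
    proof (cases "s = 0 \<or> t = 0")
      case True
      then show ?thesis using v1 * by (auto simp: lexless_def)
    next
      case False
      then have "x $ 1 = v $ 1" "y $ 1 = v $ 1" using eq by auto
      then show ?thesis using * by (intro mix) (auto simp: lexless_def)
    qed
    then show ?thesis using v1 by (simp add: lexless_def)
  qed
qed

definition is_lexmin :: "point set \<Rightarrow> point \<Rightarrow> bool" where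
  "is_lexmin K v \<longleftrightarrow> v \<in> K \<and> (\<forall>x\<in>K. \<not> lexless x v)"

lemma is_lexmin_unique: "is_lexmin K u \<Longrightarrow> is_lexmin K v \<Longrightarrow> u = v"
  unfolding is_lexmin_def lexless_def vec_eq_iff forall_2 by (meson linorder_neqE)

lemma is_lexmin_exists:
  assumes "compact K" "K \<noteq> {}"
  shows "\<exists>v. is_lexmin K v"
proof -
  have cont: "continuous_on X (\<lambda>x :: point. x $ i)" for X i by (intro continuous_intros)
  obtain u where u: "u \<in> K" "\<forall>x\<in>K. u $ 1 \<le> x $ 1"
    using continuous_attains_inf[OF assms cont] by blast
  let ?L = "K \<inter> {x. x $ 1 = u $ 1}"
  have "closed {x :: point. x $ 1 = u $ 1}" by (intro closed_Collect_eq continuous_intros)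
  then have "compact ?L" using assms(1) compact_Int_closed by blast
  moreover have "?L \<noteq> {}" using u by blast
  ultimately obtain v where v: "v \<in> ?L" "\<forall>x\<in>?L. v $ 2 \<le> x $ 2"
    using continuous_attains_inf[OF _ _ cont, of ?L 2] by blast
  then have "is_lexmin K v" using u unfolding is_lexmin_def lexless_def by force
  then show ?thesis ..
qed

definition lexmin :: "point set \<Rightarrow> point" where "lexmin K = (SOME v. is_lexmin K v)"

lemma lexmin_eqI: "is_lexmin K v \<Longrightarrow> lexmin K = v"
  unfolding lexmin_def using is_lexmin_unique by (metis someI)

text \<open>By Helly's theorem, applied to \<open>A\<close>, \<open>B\<close>, \<open>C\<close> and the convex set of all points lexicographically
  below the minimum of \<open>A \<inter> B \<inter> C\<close>.\<close>

lemma lexmin_of_pair_in_third: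
  fixes A B C :: "point set"
  assumes "compact A" "convex A" "compact B" "convex B" "compact C" "convex C"
    and ne: "A \<inter> B \<inter> C \<noteq> {}"
  shows "lexmin (A \<inter> B) \<in> C \<or> lexmin (A \<inter> C) \<in> B \<or> lexmin (B \<inter> C) \<in> A"
proof -
  have "compact (A \<inter> B \<inter> C)" using assms by (simp add: compact_Int)
  then obtain v where v: "is_lexmin (A \<inter> B \<inter> C) v" using is_lexmin_exists ne by blast
  then have vm: "v \<in> A" "v \<in> B" "v \<in> C" by (auto simp: is_lexmin_def)
  define H where "H = {x. lexless x v}"
  have vH: "v \<notin> H" by (simp add: H_def lexless_def)
  have ABCH: "A \<inter> B \<inter> C \<inter> H = {}" using v by (auto simp: is_lexmin_def H_def)
  have "A \<inter> B \<inter> H = {} \<or> A \<inter> C \<inter> H = {} \<or> B \<inter> C \<inter> H = {}"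
  \<comment> \<open>With a repeated set the empty fourfold intersection is already a triple one.
    Otherwise Helly gets four distinct sets, as \<open>v\<close> lies in the first three but not in
    \<open>H\<close>.\<close>
  proof (cases "A = B \<or> A = C \<or> B = C")
    case True
    then show ?thesis using ABCH by auto
  next
    case False
    have H: "A \<noteq> H" "B \<noteq> H" "C \<noteq> H" using vm vH by auto
    show ?thesis
    proof (rule ccontr)
      assume no: "\<not> ?thesis"
      have "\<Inter>{A, B, C, H} \<noteq> {}"
      proof (rule Helly)
        show "card {A, B, C, H} \<ge> DIM(point) + 1" using False H by simp
        show "\<forall>s\<in>{A, B, C, H}. convex s" using assms convex_lexless by (auto simp: H_def)
        fix t assume t: "t \<subseteq> {A, B, C, H}" "card t = DIM(point) + 1"
        have sub: "\<Inter>t \<noteq> {}" if XYZ: "X \<inter> Y \<inter> Z \<noteq> {}" "t \<subseteq> {X, Y, Z}" for X Y Z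
        proof -
          obtain q where "q \<in> X" "q \<in> Y" "q \<in> Z" using XYZ(1) by blast
          then have "q \<in> \<Inter>t" using XYZ(2) by auto
          then show ?thesis by blast
        qed
        have "\<not> {A, B, C, H} \<subseteq> t"
        proof
          assume "{A, B, C, H} \<subseteq> t"
          then have "t = {A, B, C, H}" using t(1) by (rule equalityI[rotated])
          then show False using t(2) False H by simp
        qed
        then have "A \<notin> t \<or> B \<notin> t \<or> C \<notin> t \<or> H \<notin> t" by simp
        moreover have "t \<subseteq> {B, C, H}" if "A \<notin> t" using t(1) that by auto
        moreover have "t \<subseteq> {A, C, H}" if "B \<notin> t" using t(1) that by auto
        moreover have "t \<subseteq> {A, B, H}" if "C \<notin> t" using t(1) that by auto
        moreover have "t \<subseteq> {A, B, C}" if "H \<notin> t" using t(1) that by auto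
        ultimately show "\<Inter>t \<noteq> {}"
          using sub[of B C H] sub[of A C H] sub[of A B H] sub[OF ne] no by argo
      qed
      then show False using ABCH by (simp add: Int_assoc)
    qed
  qed
  \<comment> \<open>An empty \<open>A \<inter> B \<inter> H\<close> says that nothing in
    \<open>A \<inter> B\<close> precedes \<open>v\<close>.\<close>
  then have "is_lexmin (A \<inter> B) v \<or> is_lexmin (A \<inter> C) v \<or> is_lexmin (B \<inter> C) v"
    using vm by (auto simp: is_lexmin_def H_def)
  then show ?thesis using lexmin_eqI vm by auto
qed

text \<open>Each meeting triple is charged to a pair whose lexicographic minimum lies in the third
  set. A pair receives at most its own weight times the largest weight \<open>m\<close> at such a
  minimum, and the three positions of the pair cancel the factor 3 of
  \<open>weighted_meeting_triples\<close>.\<close>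

lemma fractional_Helly_plane:
  fixes I :: "point set set" and w :: "point set \<Rightarrow> real"
  assumes I: "finite I" "\<And>A. A \<in> I \<Longrightarrow> compact A \<and> convex A \<and> A \<noteq> {}"
    and w: "\<And>A. A \<in> I \<Longrightarrow> w A \<ge> 0" and P: "P > 0"
    and meet: "\<And>S. S \<subseteq> I \<Longrightarrow> card S = P \<Longrightarrow>
      \<exists>A\<in>S. \<exists>B\<in>S. \<exists>C\<in>S. A \<noteq> B \<and> A \<noteq> C \<and> B \<noteq> C \<and> A \<inter> B \<inter> C \<noteq> {}"
  shows "\<exists>x. (\<Sum>A\<in>I. w A) \<le> 16 * real P ^ 2 * (\<Sum>A\<in>I. w A * of_bool (x \<in> A))"
proof (cases "(\<Sum>A\<in>I. w A) = 0")
  case True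
  moreover have "0 \<le> (\<Sum>A\<in>I. w A * of_bool (undefined \<in> A))" using w by (intro sum_nonneg) auto
  ultimately show ?thesis by (intro exI[of _ undefined]) simp
next
  case False
  define W where "W = (\<Sum>A\<in>I. w A)"
  have W: "W > 0" using False w unfolding W_def by (simp add: less_le sum_nonneg)
  define c where "c x = (\<Sum>A\<in>I. w A * of_bool (x \<in> A))" for x
  \<comment> \<open>For disjoint \<open>A\<close> and \<open>B\<close> this is an arbitrary point,
    which is harmless because it enters only an upper bound.\<close>
  define L where "L A B = lexmin (A \<inter> B)" for A B
  let ?D = "c ` ((\<lambda>(A, B). L A B) ` (I \<times> I))"
  define m where "m = Max ?D"
  have "I \<noteq> {}" using False by auto
  have finD: "finite ?D" "?D \<noteq> {}" using I(1) \<open>I \<noteq> {}\<close> by auto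
  have cm: "c (L A B) \<le> m" if "A \<in> I" "B \<in> I" for A B
    unfolding m_def using that finD by (intro Max_ge) auto
  have pair: "(\<Sum>A\<in>I. \<Sum>B\<in>I. w A * w B * c (L A B)) \<le> W ^ 2 * m"
  proof -
    have "(\<Sum>A\<in>I. \<Sum>B\<in>I. w A * w B * c (L A B)) \<le> (\<Sum>A\<in>I. \<Sum>B\<in>I. w A * w B * m)"
      using w cm by (intro sum_mono mult_left_mono) auto
    also have "\<dots> = W ^ 2 * m"
      unfolding W_def power2_eq_square sum_product by (simp add: sum_distrib_right)
    finally show ?thesis .
  qed
  have ob: "of_bool (A \<inter> B \<inter> C \<noteq> {}) \<le> 
      (of_bool (L A B \<in> C) + of_bool (L A C \<in> B) + of_bool (L B C \<in> A) :: real)"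
    if "A \<in> I" "B \<in> I" "C \<in> I" for A B C
    using lexmin_of_pair_in_third[of A B C] I(2) that by (auto simp: L_def)
  have "(\<Sum>A\<in>I. \<Sum>B\<in>I. \<Sum>C\<in>I. w A * w B * w C * of_bool (A \<inter> B \<inter> C \<noteq> {})) \<le>
    (\<Sum>A\<in>I. \<Sum>B\<in>I. \<Sum>C\<in>I. w A * w B * w C *
      (of_bool (L A B \<in> C) + of_bool (L A C \<in> B) + of_bool (L B C \<in> A)))"
    using w by (intro sum_mono mult_left_mono ob) auto
  also have "\<dots> = (\<Sum>A\<in>I. \<Sum>B\<in>I. \<Sum>C\<in>I. w A * w B * w C * of_bool (L A B \<in> C)) +
     (\<Sum>A\<in>I. \<Sum>B\<in>I. \<Sum>C\<in>I. w A * w B * w C * of_bool (L A C \<in> B)) +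
     (\<Sum>A\<in>I. \<Sum>B\<in>I. \<Sum>C\<in>I. w A * w B * w C * of_bool (L B C \<in> A))"
    by (simp only: distrib_left sum.distrib)
  also have "(\<Sum>A\<in>I. \<Sum>B\<in>I. \<Sum>C\<in>I. w A * w B * w C * of_bool (L A B \<in> C)) =
      (\<Sum>A\<in>I. \<Sum>B\<in>I. w A * w B * c (L A B))"
    unfolding c_def sum_distrib_left by (simp only: mult.assoc)
  also have "(\<Sum>A\<in>I. \<Sum>B\<in>I. \<Sum>C\<in>I. w A * w B * w C * of_bool (L A C \<in> B)) =
      (\<Sum>A\<in>I. \<Sum>C\<in>I. w A * w C * c (L A C))"
    by (rule sum.cong[OF refl], subst sum.swap) (simp only: c_def sum_distrib_left mult_ac)
  also have "(\<Sum>A\<in>I. \<Sum>B\<in>I. \<Sum>C\<in>I. w A * w B * w C * of_bool (L B C \<in> A)) =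
      (\<Sum>B\<in>I. \<Sum>A\<in>I. \<Sum>C\<in>I. w A * w B * w C * of_bool (L B C \<in> A))"
    by (rule sum.swap)
  also have "\<dots> = (\<Sum>B\<in>I. \<Sum>C\<in>I. w B * w C * c (L B C))"
    by (rule sum.cong[OF refl], subst sum.swap) (simp only: c_def sum_distrib_left mult_ac)
  finally have "(\<Sum>A\<in>I. \<Sum>B\<in>I. \<Sum>C\<in>I. w A * w B * w C * of_bool (A \<inter> B \<inter> C \<noteq> {})) \<le> 3 * (W ^ 2 * m)"
    using pair by linarith
  then have "3 * W ^ 3 \<le> 16 * real P ^ 2 * (3 * (W ^ 2 * m))"
    using weighted_meeting_triples[of I w P] I w P meet unfolding W_def
    by (smt (verit, ccfv_SIG) mult_left_mono zero_le_power2)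
  then have "(3 * W ^ 2) * W \<le> (3 * W ^ 2) * (16 * real P ^ 2 * m)"
    by (simp add: power3_eq_cube power2_eq_square mult_ac)
  then have "W \<le> 16 * real P ^ 2 * m" using W by (subst (asm) mult_le_cancel_left_pos) auto
  moreover obtain x where "m = c x" using Max_in[OF finD] unfolding m_def by blast
  ultimately show ?thesis unfolding W_def c_def by blast
qed

section \<open>Multiplicative weights and weak nets\<close>

abbreviation hits :: "point list \<Rightarrow> point set \<Rightarrow> nat" where
  "hits xs A \<equiv> length (filter (\<lambda>x. x \<in> A) xs)"

text \<open>Multiplicative weights: repeatedly pick a heavy point and halve the weight of every set it hits.\<close>

lemma multiplicative_weights:
  fixes I :: "point set set" and \<epsilon> :: real
  assumes I: "finite I" and eps: "0 < \<epsilon>"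
    and heavy: "\<And>w :: point set \<Rightarrow> real. (\<And>A. A \<in> I \<Longrightarrow> w A \<ge> 0) \<Longrightarrow>
      \<exists>x. \<epsilon> * (\<Sum>A\<in>I. w A) \<le> (\<Sum>A\<in>I. w A * of_bool (x \<in> A))"
  shows "\<exists>j xs. length xs = 2 ^ j \<and> (\<forall>A\<in>I. \<epsilon> / 4 * 2 ^ j \<le> real (hits xs A))"
proof -
  have iter: "\<exists>xs. length xs = n \<and> (\<Sum>A\<in>I. (1/2) ^ hits xs A) \<le> real (card I) * exp (- (\<epsilon> / 2 * n))" for n
  proof (induction n)
    case 0
    then show ?case by simp
  next
    case (Suc n)
    then obtain xs where xs: "length xs = n"
      "(\<Sum>A\<in>I. (1/2) ^ hits xs A) \<le> real (card I) * exp (- (\<epsilon> / 2 * n))" by blast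
    define w :: "point set \<Rightarrow> real" where "w A = (1/2) ^ hits xs A" for A
    obtain x where x: "\<epsilon> * (\<Sum>A\<in>I. w A) \<le> (\<Sum>A\<in>I. w A * of_bool (x \<in> A))"
      using heavy[of w] by (auto simp: w_def)
    have W0: "(\<Sum>A\<in>I. w A) \<ge> 0" by (intro sum_nonneg) (auto simp: w_def)
    have "(\<Sum>A\<in>I. (1/2) ^ hits (x # xs) A) = (\<Sum>A\<in>I. w A - w A * of_bool (x \<in> A) / 2)"
      by (intro sum.cong) (auto simp: w_def)
    also have "\<dots> = (\<Sum>A\<in>I. w A) - (\<Sum>A\<in>I. w A * of_bool (x \<in> A)) / 2"
      by (simp only: sum_subtractf sum_divide_distrib)
    also have "\<dots> \<le> (1 - \<epsilon> / 2) * (\<Sum>A\<in>I. w A)" using x by (simp add: left_diff_distrib)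
    also have "\<dots> \<le> exp (- (\<epsilon> / 2)) * (\<Sum>A\<in>I. w A)"
      using exp_ge_add_one_self[of "- (\<epsilon> / 2)"] W0 by (intro mult_right_mono) auto
    also have "\<dots> \<le> exp (- (\<epsilon> / 2)) * (real (card I) * exp (- (\<epsilon> / 2 * n)))"
      using xs(2) by (intro mult_left_mono) (auto simp: w_def)
    also have "\<dots> = real (card I) * exp (- (\<epsilon> / 2 * real (Suc n)))"
      by (simp add: algebra_simps flip: exp_add)
    finally show ?case using xs(1) by (intro exI[of _ "x # xs"]) auto
  qed
  \<comment> \<open>A power of two, for the halving in \<open>weak_net_plane\<close>, so large that
    \<open>ln (card I)\<close> consumes at most half of the exponent
    \<open>\<epsilon> / 2 * 2 ^ j\<close>.\<close>
  obtain j :: nat where j: "4 * ln (real (card I)) / \<epsilon> < 2 ^ j"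
    using real_arch_pow[of 2] by auto
  obtain xs where xs: "length xs = 2 ^ j"
    "(\<Sum>A\<in>I. (1/2) ^ hits xs A) \<le> real (card I) * exp (- (\<epsilon> / 2 * real (2 ^ j)))"
    using iter by blast
  have "\<epsilon> / 4 * 2 ^ j \<le> real (hits xs A)" if A: "A \<in> I" for A
  proof -
    have pos: "real (card I) > 0" using A I by (auto simp: card_gt_0_iff)
    have "(1/2) ^ hits xs A \<le> (\<Sum>A\<in>I. (1/2 :: real) ^ hits xs A)"
      using A I by (intro member_le_sum) auto
    then have "(1/2) ^ hits xs A \<le> real (card I) * exp (- (\<epsilon> / 2 * 2 ^ j))" using xs(2) by simp
    then have "ln ((1/2 :: real) ^ hits xs A) \<le> ln (real (card I) * exp (- (\<epsilon> / 2 * 2 ^ j)))"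
      using pos by (subst ln_le_cancel_iff) auto
    then have "- (real (hits xs A) * ln 2) \<le> ln (real (card I)) - \<epsilon> / 2 * 2 ^ j"
      using pos by (simp add: ln_realpow ln_div ln_mult)
    moreover have "real (hits xs A) * ln 2 \<le> real (hits xs A) * 1"
      using ln_2_less_1 by (intro mult_left_mono) auto
    moreover have "ln (real (card I)) \<le> \<epsilon> / 4 * 2 ^ j"
      using j eps by (simp add: field_simps)
    ultimately show ?thesis by linarith
  qed
  then show ?thesis using xs(1) by blast
qed

section \<open>Weak nets on a vertical line and in the plane\<close>

lemma convex_vertical_between:
  fixes K :: "point set"
  assumes K: "convex K" "u \<in> K" "v \<in> K" and c: "u $ 1 = c" "v $ 1 = c" "z $ 1 = c"
    and le: "u $ 2 \<le> z $ 2" "z $ 2 \<le> v $ 2"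
  shows "z \<in> K"
proof -
  obtain y where y: "y \<in> closed_segment u v" "y $ 2 = z $ 2"
    using connected_ivt_component_cart[of "closed_segment u v" u v 2 "z $ 2"] le by auto
  obtain t where "y = (1 - t) *\<^sub>R u + t *\<^sub>R v" using y(1) by (auto simp: in_segment)
  then have "y $ 1 = (1 - t) * c + t * c" using c by simp
  then have "y $ 1 = c" by (simp add: algebra_simps)
  then have "y = z" using y(2) c by (simp add: vec_eq_iff forall_2)
  moreover have "y \<in> K" using y(1) closed_segment_subset[OF K(2,3,1)] by blast
  ultimately show ?thesis by simp
qed

text \<open>Every \<open>q\<close>-th point in vertical order, with \<open>q\<close> the ceiling of
  \<open>s\<close>, suffices: a convex set meets the line in an interval, so it contains everything
  between its first and last point in the sorted list, at least \<open>q\<close> consecutive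
  entries.\<close>

lemma line_net:
  fixes ys :: "point list" and s :: real
  assumes s: "s > 0" and line: "\<And>y. y \<in> set ys \<Longrightarrow> y $ 1 = c"
  shows "\<exists>T. finite T \<and> real (card T) \<le> real (length ys) / s \<and>
    (\<forall>K. convex K \<and> s \<le> real (hits ys K) \<longrightarrow> T \<inter> K \<noteq> {})"
proof -
  define zs where "zs = sort_key (\<lambda>y. y $ 2) ys"
  define q where "q = nat \<lceil>s\<rceil>"
  have q: "q \<ge> 1" "s \<le> real q" using s by (simp_all add: q_def Suc_le_eq)
  define T where "T = (\<lambda>i. zs ! (q * (i + 1) - 1)) ` {..< length zs div q}"
  have len: "length zs = length ys" and hz: "hits zs K = hits ys K" for K
    by (simp_all add: zs_def filter_sort)
  have "card T \<le> length zs div q" unfolding T_def using card_image_le by fastforce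
  then have "real (card T) \<le> real (length zs) / real q"
    using of_nat_div_le_of_nat[of "length zs" q, where 'a=real] by linarith
  also have "\<dots> \<le> real (length ys) / s" using q s len by (intro frac_le) auto
  finally have c1: "real (card T) \<le> real (length ys) / s" .
  have "T \<inter> K \<noteq> {}" if K: "convex K" "s \<le> real (hits ys K)" for K
  proof -
    define Z where "Z = {i. i < length zs \<and> zs ! i \<in> K}"
    have finZ: "finite Z" by (simp add: Z_def)
    have "s \<le> real (card Z)" using K(2) hz by (simp add: Z_def length_filter_conv_card)
    then have qZ: "q \<le> card Z" unfolding q_def by (simp add: ceiling_le_iff nat_le_iff)
    then have ne: "Z \<noteq> {}" using q by auto
    define a b where "a = Min Z" and "b = Max Z"
    have ab: "a \<in> Z" "b \<in> Z" using finZ ne by (auto simp: a_def b_def)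
    have "Z \<subseteq> {a..b}" using finZ by (auto simp: a_def b_def)
    then have "card Z \<le> Suc b - a" using card_mono[of "{a..b}" Z] by simp
    then have bq: "a + q \<le> b + 1" using qZ q by simp
    \<comment> \<open>The last index of the block of length \<open>q\<close> that holds
      \<open>a\<close>; it is at most \<open>a + q - 1\<close>, hence at most
      \<open>b\<close>.\<close>
    define i where "i = q * (a div q + 1) - 1"
    have "a < q * (a div q + 1)" using dividend_less_times_div[of q a] q by simp
    moreover have "q * (a div q) \<le> a" by simp
    ultimately have i: "a \<le> i" "i \<le> b" using bq
      unfolding i_def distrib_left mult_1_right by linarith+
    have sorted: "sorted (map (\<lambda>y. y $ 2) zs)" by (simp add: zs_def)
    have bl: "b < length zs" using ab by (simp add: Z_def)
    have "zs ! a $ 2 \<le> zs ! i $ 2" "zs ! i $ 2 \<le> zs ! b $ 2"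
      using sorted_nth_mono[OF sorted, of a i] sorted_nth_mono[OF sorted, of i b] i bl by auto
    moreover have "zs ! k $ 1 = c" if "k < length zs" for k
      using line nth_mem[OF that] by (simp add: zs_def)
    ultimately have "zs ! i \<in> K"
      using convex_vertical_between[OF K(1), of "zs ! a" "zs ! b" c "zs ! i"] ab i bl
      by (simp add: Z_def)
    moreover have "a div q < length zs div q"
    proof -
      have "q * (a div q + 1) \<le> length zs" using i(2) bl unfolding i_def by linarith
      then have "a div q + 1 \<le> length zs div q" using q
        by (simp add: less_eq_div_iff_mult_less_eq mult.commute)
      then show ?thesis by simp
    qed
    ultimately show ?thesis unfolding T_def i_def by blast
  qed
  moreover have "finite T" by (simp add: T_def)
  ultimately show ?thesis using c1 by blast
qed

lemma length_filter_product:
  "length (filter (\<lambda>(a, b). P a \<and> Q b) (List.product xs ys)) =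
    length (filter P xs) * length (filter Q ys)"
  by (induction xs) (auto simp: filter_map o_def)

text \<open>A convex set containing \<open>a\<close> and \<open>b\<close> contains the crossing of
  their segment with the line, so the product of its hits on the two sides is at most its number of
  hits among all crossings.\<close>

lemma crossing_net:
  fixes L R :: "point list"
  assumes s: "s > 0" and L: "\<And>a. a \<in> set L \<Longrightarrow> a $ 1 \<le> c" and R: "\<And>b. b \<in> set R \<Longrightarrow> c \<le> b $ 1"
  shows "\<exists>T. finite T \<and> real (card T) \<le> real (length L * length R) / s \<and>
    (\<forall>K. convex K \<and> s \<le> real (hits L K) * real (hits R K) \<longrightarrow> T \<inter> K \<noteq> {})"
proof -
  \<comment> \<open>Both ends may lie on the line, so the crossing need not be unique.\<close>
  define z where "z a b = (SOME z. z \<in> closed_segment a b \<and> z $ 1 = c)" for a b :: point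
  have z: "z a b \<in> closed_segment a b \<and> z a b $ 1 = c" if "a \<in> set L" "b \<in> set R" for a b
  proof -
    have "\<exists>z. z \<in> closed_segment a b \<and> z $ 1 = c"
      using connected_ivt_component_cart[of "closed_segment a b" a b 1 c] L[OF that(1)] R[OF that(2)]
      by auto
    then show ?thesis unfolding z_def by (rule someI_ex)
  qed
  define ys where "ys = map (\<lambda>(a, b). z a b) (List.product L R)"
  have "y $ 1 = c" if "y \<in> set ys" for y using that z by (auto simp: ys_def)
  from line_net[OF s, of ys, OF this] obtain T where T: "finite T" "real (card T) \<le> real (length ys) / s"
    "\<forall>K. convex K \<and> s \<le> real (hits ys K) \<longrightarrow> T \<inter> K \<noteq> {}" by auto
  have le: "hits L K * hits R K \<le> hits ys K" if K: "convex K" for K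
  proof -
    have "hits L K * hits R K = length (filter (\<lambda>(a, b). a \<in> K \<and> b \<in> K) (List.product L R))"
      by (rule length_filter_product[symmetric])
    also have "\<dots> = length (filter (\<lambda>(a, b). a \<in> K \<and> b \<in> K \<and> z a b \<in> K) (List.product L R))"
    proof (intro arg_cong[where f=length] filter_cong refl)
      show "(case u of (a, b) \<Rightarrow> a \<in> K \<and> b \<in> K) \<longleftrightarrow>
          (case u of (a, b) \<Rightarrow> a \<in> K \<and> b \<in> K \<and> z a b \<in> K)" if u: "u \<in> set (List.product L R)" for u
      proof (cases u)
        case (Pair a b)
        then have "z a b \<in> closed_segment a b" using u z by simp
        then show ?thesis using Pair closed_segment_subset[OF _ _ K, of a b] by auto
      qed
    qed
    also have "\<dots> \<le> length (filter (\<lambda>(a, b). z a b \<in> K) (List.product L R))"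
      unfolding length_filter_conv_card by (intro card_mono) auto
    also have "\<dots> = hits ys K" by (simp add: ys_def filter_map o_def case_prod_unfold)
    finally show ?thesis .
  qed
  have "T \<inter> K \<noteq> {}" if K: "convex K" "s \<le> real (hits L K) * real (hits R K)" for K
  proof -
    have "s \<le> real (hits ys K)"
      using K(2) of_nat_mono[OF le[OF K(1)], where 'a=real] unfolding of_nat_mult by (rule order_trans)
    then show ?thesis using T(3) K(1) by blast
  qed
  moreover have "length ys = length L * length R" by (simp add: ys_def)
  ultimately show ?thesis using T(1,2) by (intro exI[of _ T]) simp
qed

text \<open>Split the points by a vertical line into halves. A convex set with three quarters of its share on
  one side is caught recursively; otherwise it contains many of the points at which the segments between
  the halves cross the line, and these form a one-dimensional problem.\<close>

lemma weak_net_plane: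
  fixes xs :: "point list" and m :: real
  assumes "length xs = 2 ^ j" "m > 0"
  shows "\<exists>T. finite T \<and> real (card T) \<le> 36 * (2 ^ j / m) ^ 2 \<and>
    (\<forall>K. convex K \<and> m \<le> real (hits xs K) \<longrightarrow> T \<inter> K \<noteq> {})"
  using assms
proof (induction j arbitrary: xs m)
  case 0
  then obtain x where xs: "xs = [x]" by (auto simp: length_Suc_conv)
  show ?case
  proof (cases "m \<le> 1")
    case True
    then have "1 \<le> (1 / m) ^ 2" using 0 by (intro one_le_power) (simp add: field_simps)
    then show ?thesis using xs 0 by (intro exI[of _ "{x}"]) auto
  next
    \<comment> \<open>A single point gives at most one hit, so no set qualifies and the empty net
      works.\<close>
    case False
    then show ?thesis using xs by (intro exI[of _ "{}"]) auto
  qed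
next
  case (Suc j)
  define zs where "zs = sort_key (\<lambda>y. y $ 1) xs"
  define L where "L = take (2 ^ j) zs"
  define R where "R = drop (2 ^ j) zs"
  define c where "c = zs ! (2 ^ j) $ 1"
  have len: "length zs = 2 * 2 ^ j" using Suc.prems by (simp add: zs_def)
  have lenL: "length L = 2 ^ j" and lenR: "length R = 2 ^ j" using len by (auto simp: L_def R_def)
  have sorted: "sorted (map (\<lambda>y. y $ 1) zs)" by (simp add: zs_def)
  have Lc: "a $ 1 \<le> c" if a: "a \<in> set L" for a
  proof -
    obtain i where "i < 2 ^ j" "a = zs ! i" using a len by (auto simp: L_def in_set_conv_nth)
    then show ?thesis using sorted_nth_mono[OF sorted, of i "2 ^ j"] len by (simp add: c_def)
  qed
  have Rc: "c \<le> b $ 1" if b: "b \<in> set R" for b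
  proof -
    obtain i where "i < 2 ^ j" "b = zs ! (2 ^ j + i)" using b len by (auto simp: R_def in_set_conv_nth)
    then show ?thesis using sorted_nth_mono[OF sorted, of "2 ^ j" "2 ^ j + i"] len by (simp add: c_def)
  qed
  have hits: "hits xs K = hits L K + hits R K" for K
  proof -
    have "hits xs K = hits zs K" by (simp add: zs_def filter_sort)
    also have "zs = L @ R" by (simp add: L_def R_def)
    finally show ?thesis by simp
  qed
  \<comment> \<open>If neither half has \<open>3 * m / 4\<close> hits, both have at least
    \<open>m / 4\<close>. A fraction above 1/sqrt(2) makes the recursion contract: with 3/4 the two
    halves use 8/9 of the bound.\<close>
  have m: "3 * m / 4 > 0" "m ^ 2 / 16 > 0" using Suc.prems by auto
  obtain TL where TL: "finite TL" "real (card TL) \<le> 36 * (2 ^ j / (3 * m / 4)) ^ 2"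
    "\<And>K. convex K \<Longrightarrow> 3 * m / 4 \<le> real (hits L K) \<Longrightarrow> TL \<inter> K \<noteq> {}"
    using Suc.IH[OF lenL m(1)] by blast
  obtain TR where TR: "finite TR" "real (card TR) \<le> 36 * (2 ^ j / (3 * m / 4)) ^ 2"
    "\<And>K. convex K \<Longrightarrow> 3 * m / 4 \<le> real (hits R K) \<Longrightarrow> TR \<inter> K \<noteq> {}"
    using Suc.IH[OF lenR m(1)] by blast
  obtain TC where TC: "finite TC" "real (card TC) \<le> real (length L * length R) / (m ^ 2 / 16)"
    "\<And>K. convex K \<Longrightarrow> m ^ 2 / 16 \<le> real (hits L K) * real (hits R K) \<Longrightarrow> TC \<inter> K \<noteq> {}"
    using crossing_net[of "m ^ 2 / 16" L c R] m(2) Lc Rc by blast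
  have "real (card (TL \<union> TR \<union> TC)) \<le> real (card TL) + real (card TR) + real (card TC)"
    using card_Un_le[of TL TR] card_Un_le[of "TL \<union> TR" TC] by linarith
  also have "\<dots> \<le> 2 * (36 * (2 ^ j / (3 * m / 4)) ^ 2) + 2 ^ j * 2 ^ j / (m ^ 2 / 16)"
    using TL(2) TR(2) TC(2) lenL lenR by simp
  \<comment> \<open>36 is the fixed point of the recursion: 2 * 36 * 16/9 + 16 = 4 * 36.\<close>
  also have "\<dots> = 36 * (2 ^ Suc j / m) ^ 2"
    by (simp add: power2_eq_square)
  finally have card: "real (card (TL \<union> TR \<union> TC)) \<le> 36 * (2 ^ Suc j / m) ^ 2" .
  have "(TL \<union> TR \<union> TC) \<inter> K \<noteq> {}" if K: "convex K" "m \<le> real (hits xs K)" for K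
  proof (cases "3 * m / 4 \<le> real (hits L K) \<or> 3 * m / 4 \<le> real (hits R K)")
    case True
    then show ?thesis using TL(3)[OF K(1)] TR(3)[OF K(1)] by blast
  next
    case False
    then have "m / 4 \<le> real (hits L K)" "m / 4 \<le> real (hits R K)" using K(2) hits[of K] by auto
    then have "m / 4 * (m / 4) \<le> real (hits L K) * real (hits R K)"
      using Suc.prems(2) by (intro mult_mono) auto
    then have "m ^ 2 / 16 \<le> real (hits L K) * real (hits R K)" by (simp add: power2_eq_square)
    then show ?thesis using TC(3)[OF K(1)] by blast
  qed
  then show ?case using TL(1) TR(1) TC(1) card by (intro exI[of _ "TL \<union> TR \<union> TC"]) auto
qed

text \<open>A homeomorphism of the plane onto the open disc makes the candidate point tuples live in a compact
  product of closed discs.\<close>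

lemma transversal_compactness:
  fixes F :: "point set set"
  assumes cp: "\<And>A. A \<in> F \<Longrightarrow> compact A"
    and fin: "\<And>G. finite G \<Longrightarrow> G \<subseteq> F \<Longrightarrow> \<exists>T. finite T \<and> card T \<le> N \<and> transversal T G"
  shows "\<exists>T. finite T \<and> card T \<le> N \<and> transversal T F"
proof -
  have "(UNIV :: point set) homeomorphic ball (0 :: point) 1"
    using homeomorphic_ball_UNIV[of 1 "0 :: point"] homeomorphic_sym by auto
  then obtain h g where hg: "homeomorphism (UNIV :: point set) (ball (0 :: point) 1) h g"
    unfolding homeomorphic_def by blast
  then have gh: "g (h x) = x" and hb: "h x \<in> cball 0 1" and ch: "continuous_on UNIV h" for x
    unfolding homeomorphism_def by (auto simp: less_eq_real_def)
  define X where "X = product_topology (\<lambda>_ :: nat. top_of_set (cball (0 :: point) 1)) {..<N}"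
  have top: "topspace X = PiE {..<N} (\<lambda>_. cball 0 1)" by (simp add: X_def)
  have cX: "compact_space X"
    unfolding X_def compact_space_product_topology by (simp add: compact_space_subtopology)
  \<comment> \<open>Boundary entries of a tuple stand for no point of the plane, but membership asks
    for an entry in the compact image of \<open>A\<close>, inside the open disc.\<close>
  define D where "D A = {f \<in> topspace X. \<exists>i<N. f i \<in> h ` A}" for A
  have clD: "closedin X (D A)" if A: "A \<in> F" for A
  proof -
    have "compact (h ` A)"
      using cp[OF A] ch continuous_on_subset by (blast intro: compact_continuous_image)
    then have "closedin (top_of_set (cball 0 1)) (h ` A)"
      using hb by (auto simp: closedin_closed_eq compact_imp_closed intro!: closed_subset)
    then have "closedin X {f \<in> topspace X. f i \<in> h ` A}" if "i < N" for i
      using that unfolding X_def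
      by (intro closedin_continuous_map_preimage[OF continuous_map_product_projection]) auto
    then have "closedin X (\<Union>i\<in>{..<N}. {f \<in> topspace X. f i \<in> h ` A})"
      by (intro closedin_Union) auto
    moreover have "(\<Union>i\<in>{..<N}. {f \<in> topspace X. f i \<in> h ` A}) = D A" by (auto simp: D_def)
    ultimately show ?thesis by simp
  qed
  have "\<Inter>(D ` F) \<noteq> {}"
  proof (rule compact_space_fip[THEN iffD1, OF cX, rule_format], intro conjI allI impI ballI)
    show "closedin X C" if "C \<in> D ` F" for C using that clD by blast
    fix \<U> assume "finite \<U> \<and> \<U> \<subseteq> D ` F"
    then obtain G where G: "G \<subseteq> F" "finite G" "\<U> = D ` G" by (meson finite_subset_image)
    then obtain T where T: "finite T" "card T \<le> N" "transversal T G" using fin by blast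
    obtain e where e: "bij_betw e {0..<card T} T" using ex_bij_betw_nat_finite[OF T(1)] by blast
    \<comment> \<open>Indices from \<open>card T\<close> on receive arbitrary points of the disc as
      padding.\<close>
    define f where "f = restrict (\<lambda>i. h (e i)) {..<N}"
    have "f \<in> D A" if "A \<in> G" for A
    proof -
      obtain t where t: "t \<in> T" "t \<in> A" using T(3) \<open>A \<in> G\<close> by (auto simp: transversal_def)
      then have "t \<in> e ` {0..<card T}" using e by (simp add: bij_betw_def)
      then obtain i where i: "i < card T" "e i = t" by auto
      then have "i < N" using T(2) by simp
      moreover have "f i \<in> h ` A" using i t \<open>i < N\<close> by (auto simp: f_def)
      moreover have "f \<in> topspace X" using hb by (auto simp: top f_def)
      ultimately show ?thesis by (auto simp: D_def)
    qed
    then show "\<Inter>\<U> \<noteq> {}" using G(3) by blast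
  qed
  then obtain f where f: "\<And>A. A \<in> F \<Longrightarrow> f \<in> D A" by blast
  have "transversal ((\<lambda>i. g (f i)) ` {..<N}) F"
    unfolding transversal_def
  proof
    fix A assume "A \<in> F"
    then obtain i a where "i < N" "a \<in> A" "f i = h a" using f[of A] by (auto simp: D_def)
    then show "(\<lambda>i. g (f i)) ` {..<N} \<inter> A \<noteq> {}" using gh by force
  qed
  moreover have "card ((\<lambda>i. g (f i)) ` {..<N}) \<le> N" using card_image_le[of "{..<N}"] by simp
  ultimately show ?thesis by blast
qed

text \<open>The triple condition is assumed in place of the (p,2)-property because it passes to
  every subfamily, even one with fewer than \<open>p\<close> members.\<close>

lemma finite_family_transversal:
  fixes G :: "point set set"
  assumes G: "finite G" "\<And>A. A \<in> G \<Longrightarrow> compact A \<and> convex A \<and> A \<noteq> {}" and P: "P > 0"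
    and meet: "\<And>S. S \<subseteq> G \<Longrightarrow> card S = P \<Longrightarrow>
      \<exists>A\<in>S. \<exists>B\<in>S. \<exists>C\<in>S. A \<noteq> B \<and> A \<noteq> C \<and> B \<noteq> C \<and> A \<inter> B \<inter> C \<noteq> {}"
  shows "\<exists>T. finite T \<and> card T \<le> 147456 * P ^ 4 \<and> transversal T G"
proof -
  define \<epsilon> where "\<epsilon> = 1 / (16 * real P ^ 2)"
  have eps: "\<epsilon> > 0" using P by (simp add: \<epsilon>_def)
  have "\<exists>x. \<epsilon> * (\<Sum>A\<in>G. w A) \<le> (\<Sum>A\<in>G. w A * of_bool (x \<in> A))"
    if w: "\<And>A. A \<in> G \<Longrightarrow> w A \<ge> 0" for w :: "point set \<Rightarrow> real"
  proof -
    obtain x where "(\<Sum>A\<in>G. w A) \<le> 16 * real P ^ 2 * (\<Sum>A\<in>G. w A * of_bool (x \<in> A))"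
      using fractional_Helly_plane[of G w P] G w P meet by blast
    then have "(\<Sum>A\<in>G. w A) / (16 * real P ^ 2) \<le> (\<Sum>A\<in>G. w A * of_bool (x \<in> A))"
      using P by (subst pos_divide_le_eq) (auto simp: mult.commute)
    then show ?thesis by (auto simp: \<epsilon>_def)
  qed
  from multiplicative_weights[OF G(1) eps this]
  obtain j xs where xs: "length xs = 2 ^ j" "\<And>A. A \<in> G \<Longrightarrow> \<epsilon> / 4 * 2 ^ j \<le> real (hits xs A)"
    by blast
  have "\<epsilon> / 4 * 2 ^ j > 0" using eps by simp
  from weak_net_plane[OF xs(1) this] obtain T where T: "finite T"
    "real (card T) \<le> 36 * (2 ^ j / (\<epsilon> / 4 * 2 ^ j)) ^ 2"
    "\<And>K. convex K \<Longrightarrow> \<epsilon> / 4 * 2 ^ j \<le> real (hits xs K) \<Longrightarrow> T \<inter> K \<noteq> {}" by blast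
  have "36 * (2 ^ j / (\<epsilon> / 4 * 2 ^ j)) ^ 2 = 147456 * real P ^ 4"
    by (simp add: \<epsilon>_def power_divide power_mult_distrib flip: power_mult)
  then have "card T \<le> 147456 * P ^ 4"
    using T(2) by (metis of_nat_le_iff of_nat_mult of_nat_numeral of_nat_power)
  moreover have "transversal T G" using T(3) xs(2) G(2) by (auto simp: transversal_def)
  ultimately show ?thesis using T(1) by blast
qed

theorem theorem1p7:
  "\<exists>C::real. \<forall>(p::nat) (k::nat) (F::point set set).
     p \<ge> 2 \<longrightarrow> k \<ge> 3 \<longrightarrow>
     (\<forall>A\<in>F. compact A \<and> convex A) \<longrightarrow>
     pq_property p 2 F \<longrightarrow>
     (\<forall>G \<subseteq> F. finite G \<and> card G = k \<longrightarrow> union_complexity_less G (k choose 2)) \<longrightarrow>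
     (\<exists>T. finite T \<and> real (card T) \<le> C * real k ^ 4 * real p ^ 16 \<and> transversal T F)"
proof (intro exI[of _ 147456] allI impI)
  fix p k :: nat and F :: "point set set"
  assume p: "p \<ge> 2" and k: "k \<ge> 3" and cc: "\<forall>A\<in>F. compact A \<and> convex A" and pq: "pq_property p 2 F"
    and uc: "\<forall>G \<subseteq> F. finite G \<and> card G = k \<longrightarrow> union_complexity_less G (k choose 2)"
  define P where "P = k * p ^ 4"
  have P: "P > 0" using p k by (simp add: P_def)
  have ne: "A \<noteq> {}" if "A \<in> F" for A using pq that by (auto simp: pq_property_def)
  have "\<exists>T. finite T \<and> card T \<le> 147456 * P ^ 4 \<and> transversal T F"
  proof (rule transversal_compactness)
    fix G assume G: "finite G" "G \<subseteq> F"
    show "\<exists>T. finite T \<and> card T \<le> 147456 * P ^ 4 \<and> transversal T G"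
    proof (rule finite_family_transversal[OF G(1) _ P])
      show "compact A \<and> convex A \<and> A \<noteq> {}" if "A \<in> G" for A using that G(2) cc ne by blast
      show "\<exists>A\<in>S. \<exists>B\<in>S. \<exists>C\<in>S. A \<noteq> B \<and> A \<noteq> C \<and> B \<noteq> C \<and> A \<inter> B \<inter> C \<noteq> {}"
        if "S \<subseteq> G" "card S = P" for S
        using three_members_meet[OF p k cc pq uc, of S] that G finite_subset[of S G]
        unfolding P_def by auto
    qed
  qed (use cc in blast)
  then obtain T where T: "finite T" "card T \<le> 147456 * P ^ 4" "transversal T F" by blast
  have "real (card T) \<le> real (147456 * P ^ 4)" using T(2) by (rule of_nat_mono)
  also have "\<dots> = 147456 * real k ^ 4 * real p ^ 16"
    by (simp add: P_def power_mult_distrib flip: power_mult)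
  finally show "\<exists>T. finite T \<and> real (card T) \<le> 147456 * real k ^ 4 * real p ^ 16 \<and> transversal T F"
    using T by blast
qed

end
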